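(* Let $n\ge 2$, let $P=(p_1,\dots,p_n)$ and $Q=(q_1,\dots,q_n)$ be elements of $\Gamma_n$, and let $r,R$ be real numbers with $0<r\le \frac{p_i}{q_i}\le R<\infty$ for all $i\in\{1,\dots,n\}$. Then $$\frac{(r+1)(r+3)}{8}\,\Delta(P\|Q)\le D(P\|Q)\le \frac{(R+1)(R+3)}{8}\,\Delta(P\|Q).$$
   Context: $\Gamma_n=\{P=(p_1,\dots,p_n): p_i>0,\ \sum_{i=1}^n p_i=1\}$ is the set of finite discrete probability distributions with strictly positive entries. $\ln$ is the natural logarithm. The relative J-divergence is $D(P\|Q)=\sum_{i=1}^n (p_i-q_i)\ln\left(\frac{p_i+q_i}{2q_i}\right)$. The triangular discrimination is $\Delta(P\|Q)=\sum_{i=1}^n \frac{(p_i-q_i)^2}{p_i+q_i}$. *)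

theory Defs
  imports Complex_Main
begin

text \<open>
  An \<open>n\<close>-tuple is a function on \<open>nat\<close> of which only the values on \<open>{1..n}\<close> matter;
  values outside this range are unconstrained and are never used.
\<close>

definition Gamma_simplex :: "nat \<Rightarrow> (nat \<Rightarrow> real) set" where
  "Gamma_simplex n = {p. (\<forall>i\<in>{1..n}. p i > 0) \<and> (\<Sum>i=1..n. p i) = 1}"

definition relative_J_divergence :: "nat \<Rightarrow> (nat \<Rightarrow> real) \<Rightarrow> (nat \<Rightarrow> real) \<Rightarrow> real" where
  "relative_J_divergence n p q = (\<Sum>i=1..n. (p i - q i) * ln ((p i + q i) / (2 * q i)))"

definition triangular_discrimination :: "nat \<Rightarrow> (nat \<Rightarrow> real) \<Rightarrow> (nat \<Rightarrow> real) \<Rightarrow> real" where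
  "triangular_discrimination n p q = (\<Sum>i=1..n. (p i - q i)^2 / (p i + q i))"

end

theory Submission
  imports Defs
begin

text \<open>
  With \<open>t = (p + q) / (2 q)\<close> the summands of the two divergences are \<open>2 q (t - 1) ln t\<close> and
  \<open>2 q (t - 1)\<^sup>2 / t\<close>, and \<open>(x + 1) (x + 3) / 8\<close> at \<open>x = p / q = 2 t - 1\<close> is
  \<open>t (t + 1) / 2\<close>. The inequality \<open>ln s \<le> s - 1\<close>, applied at \<open>1 / t\<close> and at \<open>t\<^sup>2\<close>, gives
  \<open>1 - 1 / t \<le> ln t \<le> (t\<^sup>2 - 1) / 2\<close>, which says that the quotient of the summands lies
  between \<open>1\<close> and \<open>t (t + 1) / 2\<close>. Summing \<open>r q\<^sub>i \<le> p\<^sub>i \<le> R q\<^sub>i\<close> yields \<open>r \<le> 1 \<le> R\<close>,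
  so the claim holds term by term.
\<close>

lemma one_minus_inverse_le_ln:
  fixes t :: real
  assumes "0 < t"
  shows "(t - 1) / t \<le> ln t"
  using ln_le_minus_one[of "1 / t"] assms by (simp add: ln_div field_simps)

lemma ln_le_half_square_minus_one:
  fixes t :: real
  assumes "0 < t"
  shows "ln t \<le> (t\<^sup>2 - 1) / 2"
  using ln_le_minus_one[of "t\<^sup>2"] assms by (simp add: ln_realpow)

text \<open>Which of 1 and \<open>t * (t + 1) / 2\<close> is smaller depends on the side of 1 on
  which \<open>t\<close> lies. Hence \<open>c\<close> is bounded by both, and each case uses one of
  the bounds.\<close>

lemma diff_one_times_ln_ge:
  fixes t c :: real
  assumes "0 < t" "c \<le> 1" "c \<le> t * (t + 1) / 2"
  shows "c * ((t - 1)\<^sup>2 / t) \<le> (t - 1) * ln t"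
proof (cases "1 \<le> t")
  case True
  have "c * ((t - 1)\<^sup>2 / t) \<le> 1 * ((t - 1)\<^sup>2 / t)"
    using assms by (intro mult_right_mono) auto
  also have "\<dots> = (t - 1) * ((t - 1) / t)"
    by (simp add: power2_eq_square)
  also have "\<dots> \<le> (t - 1) * ln t"
    using True one_minus_inverse_le_ln[OF assms(1)] by (intro mult_left_mono) auto
  finally show ?thesis .
next
  case False
  have "c * ((t - 1)\<^sup>2 / t) \<le> t * (t + 1) / 2 * ((t - 1)\<^sup>2 / t)"
    using assms by (intro mult_right_mono) auto
  also have "\<dots> = (t - 1) * ((t\<^sup>2 - 1) / 2)"
    using assms(1) by (simp add: field_simps power2_eq_square)
  \<comment> \<open>As \<open>t - 1\<close> is negative, the upper bound on \<open>ln t\<close>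
    bounds the product from below.\<close>
  also have "\<dots> \<le> (t - 1) * ln t"
    using False ln_le_half_square_minus_one[OF assms(1)] by (intro mult_left_mono_neg) auto
  finally show ?thesis .
qed

text \<open>Mirror image of \<open>diff_one_times_ln_ge\<close>: the two estimates of
  \<open>ln t\<close> swap cases.\<close>

lemma diff_one_times_ln_le:
  fixes t c :: real
  assumes "0 < t" "1 \<le> c" "t * (t + 1) / 2 \<le> c"
  shows "(t - 1) * ln t \<le> c * ((t - 1)\<^sup>2 / t)"
proof (cases "1 \<le> t")
  case True
  have "(t - 1) * ln t \<le> (t - 1) * ((t\<^sup>2 - 1) / 2)"
    using True ln_le_half_square_minus_one[OF assms(1)] by (intro mult_left_mono) auto
  also have "\<dots> = t * (t + 1) / 2 * ((t - 1)\<^sup>2 / t)"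
    using assms(1) by (simp add: field_simps power2_eq_square)
  also have "\<dots> \<le> c * ((t - 1)\<^sup>2 / t)"
    using assms by (intro mult_right_mono) auto
  finally show ?thesis .
next
  case False
  have "(t - 1) * ln t \<le> (t - 1) * ((t - 1) / t)"
    using False one_minus_inverse_le_ln[OF assms(1)] by (intro mult_left_mono_neg) auto
  also have "\<dots> = 1 * ((t - 1)\<^sup>2 / t)"
    by (simp add: power2_eq_square)
  also have "\<dots> \<le> c * ((t - 1)\<^sup>2 / t)"
    using assms by (intro mult_right_mono) auto
  finally show ?thesis .
qed

lemma coefficient_mono:
  fixes x y :: real
  assumes "0 \<le> x" "x \<le> y"
  shows "(x + 1) * (x + 3) / 8 \<le> (y + 1) * (y + 3) / 8"
  using assms by (intro divide_right_mono mult_mono) auto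

lemma summand_bounds:
  fixes p q r R :: real
  assumes "0 < p" "0 < q" "0 < r" "r \<le> 1" "1 \<le> R" "r \<le> p / q" "p / q \<le> R"
  shows "(r + 1) * (r + 3) / 8 * ((p - q)\<^sup>2 / (p + q)) \<le> (p - q) * ln ((p + q) / (2 * q))"
    and "(p - q) * ln ((p + q) / (2 * q)) \<le> (R + 1) * (R + 3) / 8 * ((p - q)\<^sup>2 / (p + q))"
proof -
  define t where "t = (p + q) / (2 * q)"
  have t: "0 < t"
    using assms by (simp add: t_def)
  have coeff: "t * (t + 1) / 2 = (p / q + 1) * (p / q + 3) / 8"
    using assms by (simp add: t_def field_simps)
  have diff: "p - q = 2 * q * (t - 1)" and sum: "p + q = 2 * q * t"
    using assms by (simp_all add: t_def field_simps)
  have D: "(p - q) * ln ((p + q) / (2 * q)) = 2 * q * ((t - 1) * ln t)"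
    by (simp add: diff flip: t_def)
  have Delta: "(p - q)\<^sup>2 / (p + q) = 2 * q * ((t - 1)\<^sup>2 / t)"
    unfolding diff sum using assms t by (simp add: power2_eq_square)
  \<comment> \<open>The coefficient \<open>(x + 1) * (x + 3) / 8\<close> equals 1 at
    \<open>x = 1\<close>, so by monotonicity \<open>r \<le> 1\<close> and
    \<open>r \<le> p / q\<close> give the two bounds required of \<open>c\<close>.\<close>
  have "(r + 1) * (r + 3) / 8 * ((t - 1)\<^sup>2 / t) \<le> (t - 1) * ln t"
    using t coefficient_mono[of r 1] coefficient_mono[of r "p / q"] assms
    by (intro diff_one_times_ln_ge) (auto simp: coeff)
  from mult_left_mono[OF this, of "2 * q"] assms
  show "(r + 1) * (r + 3) / 8 * ((p - q)\<^sup>2 / (p + q)) \<le> (p - q) * ln ((p + q) / (2 * q))"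
    unfolding D Delta by (simp add: mult_ac)
  have "(t - 1) * ln t \<le> (R + 1) * (R + 3) / 8 * ((t - 1)\<^sup>2 / t)"
    using t coefficient_mono[of 1 R] coefficient_mono[of "p / q" R] assms
    by (intro diff_one_times_ln_le) (auto simp: coeff)
  from mult_left_mono[OF this, of "2 * q"] assms
  show "(p - q) * ln ((p + q) / (2 * q)) \<le> (R + 1) * (R + 3) / 8 * ((p - q)\<^sup>2 / (p + q))"
    unfolding D Delta by (simp add: mult_ac)
qed

theorem proposition4p1:
  fixes n :: nat and p q :: "nat \<Rightarrow> real" and r R :: real
  assumes "n \<ge> 2"
    and "p \<in> Gamma_simplex n" and "q \<in> Gamma_simplex n"
    and "0 < r"
    and "\<And>i. i \<in> {1..n} \<Longrightarrow> r \<le> p i / q i \<and> p i / q i \<le> R"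
  shows "(r + 1) * (r + 3) / 8 * triangular_discrimination n p q \<le> relative_J_divergence n p q
       \<and> relative_J_divergence n p q \<le> (R + 1) * (R + 3) / 8 * triangular_discrimination n p q"
proof -
  have pos: "0 < p i" "0 < q i" if "i \<in> {1..n}" for i
    using assms(2,3) that by (auto simp: Gamma_simplex_def)
  have sums: "(\<Sum>i=1..n. p i) = 1" "(\<Sum>i=1..n. q i) = 1"
    using assms(2,3) by (auto simp: Gamma_simplex_def)
  \<comment> \<open>A single ratio may lie on either side of 1; the comparison with 1 comes from the
    equal total masses of \<open>p\<close> and \<open>q\<close>.\<close>
  have "(\<Sum>i=1..n. r * q i) \<le> (\<Sum>i=1..n. p i)"
    using assms(5) pos by (intro sum_mono) (simp add: pos_le_divide_eq)
  then have r: "r \<le> 1"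
    unfolding sum_distrib_left[symmetric] sums by simp
  have "(\<Sum>i=1..n. p i) \<le> (\<Sum>i=1..n. R * q i)"
    using assms(5) pos by (intro sum_mono) (simp add: pos_divide_le_eq)
  then have R: "1 \<le> R"
    unfolding sum_distrib_left[symmetric] sums by simp
  show ?thesis
    unfolding triangular_discrimination_def relative_J_divergence_def sum_distrib_left
    using assms(4,5) r R by (intro conjI sum_mono summand_bounds pos) auto
qed

end
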